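(* Let $n,s\ge 1$ be integers and let $\mathbf{M}\in\mathbb{R}^{(n+s)\times n}$ be the coding matrix of an $s$-diagonal code all of whose entries $m_{ij}$ with $\max\{1,i-s\}\le j\le \min\{i,n\}$ are nonzero and all of whose $n\times n$ submatrices are nonsingular. Let $U=\{i_1,\dots,i_n\}\subseteq[n+s]$ with $1\le i_1<\cdots<i_n\le n+s$ be the index set of any $n$ received results $\tilde{\mathbf{y}}_{i_1},\dots,\tilde{\mathbf{y}}_{i_n}$, and let $k$ be the index such that $i_k\le n<i_{k+1}$ (i.e. $k=|U\cap[n]|$). Run the hybrid decoding algorithm, recovering the blocks $\mathbf{A}_i\mathbf{x}$ with $i\in[n]\setminus\{i_1,\dots,i_k\}$ by rooting steps. Then the algorithm recovers all blocks of $\mathbf{y}=\mathbf{A}\mathbf{x}$ using at most $s$ rooting steps, and the total decoding time is $O(rs)$.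
   Context: Setting (coded distributed linear transform): a matrix $\mathbf{A}\in\mathbb{R}^{r\times t}$ (with $n\mid r$) is divided along its rows into $n$ blocks $\mathbf{A}_1,\dots,\mathbf{A}_n\in\mathbb{R}^{\frac{r}{n}\times t}$, and $\mathbf{x}\in\mathbb{R}^t$. There are $m=n+s$ workers. For a coding matrix $\mathbf{M}=[m_{ij}]\in\mathbb{R}^{m\times n}$, worker $i$ returns $\tilde{\mathbf{y}}_i=\tilde{\mathbf{A}}_i\mathbf{x}$ with $\tilde{\mathbf{A}}_i=\sum_{j=1}^n m_{ij}\mathbf{A}_j$. In the $s$-diagonal code, $m_{ij}=0$ unless $\max\{1,i-s\}\le j\le \min\{i,n\}$. Hybrid decoding algorithm. Input: the $n$ results $\tilde{\mathbf{y}}_i$, $i\in U$, with coefficient matrix $\mathbf{M}^U$ (the $n\times n$ submatrix of rows of $\mathbf{M}$ indexed by $U$, with $\operatorname{rank}(\mathbf{M}^U)=n$). Two kinds of steps recover a block $\mathbf{A}_i\mathbf{x}$: - Peeling step: if some row $i'$ of the current coefficient matrix has exactly one nonzero entry (a "ripple"), in column $i$, recover $\mathbf{A}_i\mathbf{x}$ from the current $\tilde{\mathbf{y}}_{i'}$ (by dividing by that entry). - Rooting step: for a chosen block index $i$, recover $\mathbf{A}_i\mathbf{x}=\sum_{k\in U}u_k\tilde{\mathbf{y}}_k$, where $\mathbf{u}$ solves $(\mathbf{M}^U)^{\intercal}\mathbf{u}=\mathbf{e}_i$ ($\mathbf{e}_i$ the $i$-th unit vector in $\mathbb{R}^n$).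 After each recovered block $\mathbf{A}_i\mathbf{x}$, for each $j\in U$ whose current coefficient $m_{ji}$ is nonzero, replace $\tilde{\mathbf{y}}_j$ by $\tilde{\mathbf{y}}_j-m_{ji}\mathbf{A}_i\mathbf{x}$ and set $m_{ji}=0$. This is repeated until every block is recovered. In the version considered here, the rooting steps for the blocks $i\in[n]\setminus\{i_1,\dots,i_k\}$ are carried out, and all remaining blocks are to be recovered by peeling steps. Cost model: decoding time counts arithmetic operations on the result vectors (which have length $r/n$), so an update $\tilde{\mathbf{y}}_j\leftarrow\tilde{\mathbf{y}}_j-m_{ji}\mathbf{A}_i\mathbf{x}$ costs $O(r/n)$ and forming one rooting-step linear combination costs $O(r)$; the vectors $\mathbf{u}$, which depend only on $\mathbf{M}^U$, are regarded as precomputed. The constant in $O(rs)$ is absolute. *)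

theory Defs
  imports "Jordan_Normal_Form.DL_Submatrix"
begin

text \<open>Workers, blocks and rows are numbered from 0: the workers are \<open>{0..<n + s}\<close> and the blocks
  \<open>{0..<n}\<close>.  In this numbering the band \<open>max {1, i - s} \<le> j \<le> min {i, n}\<close> of an \<open>s\<close>-diagonal code
  becomes \<open>i - s \<le> j \<le> i\<close> (over the integers) together with \<open>j < n\<close>.\<close>

definition in_band :: "nat \<Rightarrow> nat \<Rightarrow> nat \<Rightarrow> bool" where
  "in_band s i j \<longleftrightarrow> i \<le> j + s \<and> j \<le> i"

definition s_diagonal_code :: "nat \<Rightarrow> nat \<Rightarrow> real mat \<Rightarrow> bool" where
  "s_diagonal_code n s M \<longleftrightarrow> M \<in> carrier_mat (n + s) n \<and>
     (\<forall>i<n + s. \<forall>j<n. \<not> in_band s i j \<longrightarrow> M $$ (i, j) = 0)"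

definition row_submatrix :: "nat \<Rightarrow> real mat \<Rightarrow> nat set \<Rightarrow> real mat" where
  "row_submatrix n M W = submatrix M W {0..<n}"

definition row_block :: "nat \<Rightarrow> real mat \<Rightarrow> nat \<Rightarrow> real mat" where
  "row_block n A j = (let q = dim_row A div n in
     mat q (dim_col A) (\<lambda>(a, b). A $$ (j * q + a, b)))"

definition coded_block :: "nat \<Rightarrow> real mat \<Rightarrow> real mat \<Rightarrow> nat \<Rightarrow> real mat" where
  "coded_block n M A i = mat (dim_row A div n) (dim_col A)
     (\<lambda>(a, b). \<Sum>j<n. M $$ (i, j) * row_block n A j $$ (a, b))"

text \<open>The decoder state: the current coefficients and results (meaningful for workers in \<open>U\<close> only),
  the blocks recovered so far, the number of rooting steps, and the number of scalar arithmetic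
  operations performed on result vectors.\<close>

record decoder =
  cur_coeff :: "nat \<Rightarrow> nat \<Rightarrow> real"
  cur_result :: "nat \<Rightarrow> real vec"
  recovered :: "nat \<Rightarrow> real vec option"
  rootings :: nat
  time :: nat

definition init_decoder :: "nat \<Rightarrow> real mat \<Rightarrow> real mat \<Rightarrow> real vec \<Rightarrow> decoder" where
  "init_decoder n M A x =
     \<lparr>cur_coeff = (\<lambda>j i. M $$ (j, i)),
      cur_result = (\<lambda>j. coded_block n M A j *\<^sub>v x),
      recovered = (\<lambda>i. None), rootings = 0, time = 0\<rparr>"

text \<open>Record block \<open>i\<close> with value \<open>v\<close> (of length \<open>q\<close>) and eliminate it from every result in which it
  still occurs.  Each such update is one multiplication and one subtraction per entry.\<close>

definition recover_block :: "nat \<Rightarrow> nat set \<Rightarrow> nat \<Rightarrow> real vec \<Rightarrow> decoder \<Rightarrow> decoder" where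
  "recover_block q U i v \<sigma> =
     (let J = {j \<in> U. cur_coeff \<sigma> j i \<noteq> 0} in
      \<sigma>\<lparr>cur_coeff := (\<lambda>j l. if j \<in> J \<and> l = i then 0 else cur_coeff \<sigma> j l),
        cur_result := (\<lambda>j. if j \<in> J then cur_result \<sigma> j - cur_coeff \<sigma> j i \<cdot>\<^sub>v v
                           else cur_result \<sigma> j),
        recovered := (recovered \<sigma>)(i \<mapsto> v),
        time := time \<sigma> + card J * (2 * q)\<rparr>)"

text \<open>One step of hybrid decoding in which the blocks in \<open>R\<close> are the ones recovered by rooting.
  The steps may be interleaved in any order.  Here \<open>q\<close> is the length of the result vectors.

  Peeling costs one division per entry.  In a rooting step the linear combination of \<open>n\<close> results
  costs \<open>n\<close> multiplications and \<open>n - 1\<close> additions per entry; \<open>M\<close> is the initial coding matrix, and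
  position \<open>l\<close> of the vector \<open>u\<close> belongs to the worker \<open>pick U l\<close>, the \<open>l\<close>-th smallest element of
  \<open>U\<close>, in accordance with the row order of \<^const>\<open>submatrix\<close>.\<close>

inductive decode_step ::
    "nat \<Rightarrow> nat \<Rightarrow> real mat \<Rightarrow> nat set \<Rightarrow> nat set \<Rightarrow> decoder \<Rightarrow> decoder \<Rightarrow> bool"
  for n q :: nat and M :: "real mat" and U R :: "nat set"
where
  peel: "decode_step n q M U R \<sigma> (\<sigma>'\<lparr>time := time \<sigma>' + q\<rparr>)"
  if "i' \<in> U" and "{l \<in> {0..<n}. cur_coeff \<sigma> i' l \<noteq> 0} = {i}" and "i \<notin> R"
    and "\<sigma>' = recover_block q U i ((1 / cur_coeff \<sigma> i' i) \<cdot>\<^sub>v cur_result \<sigma> i') \<sigma>"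
| root: "decode_step n q M U R \<sigma>
      (\<sigma>'\<lparr>rootings := rootings \<sigma>' + 1, time := time \<sigma>' + (n + (n - 1)) * q\<rparr>)"
  if "i \<in> R" and "recovered \<sigma> i = None"
    and "u \<in> carrier_vec n" and "transpose_mat (row_submatrix n M U) *\<^sub>v u = unit_vec n i"
    and "\<sigma>' = recover_block q U i
           (vec q (\<lambda>a. \<Sum>l<n. u $ l * cur_result \<sigma> (pick U l) $ a)) \<sigma>"

end

theory Submission
  imports Defs
begin

text \<open>Every row \<open>i \<in> U\<close> with \<open>i < n\<close> is supported on the columns \<open>\<le> i\<close> and has a nonzero diagonal entry.
  Hence, once all blocks outside \<open>U\<close> are rooted, the least unrecovered block \<open>i\<close> is a ripple in row
  \<open>i\<close>, so peeling never gets stuck.  Workers with index \<open>\<ge> n\<close> number at most \<open>s\<close>, so at most \<open>s\<close> of the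
  first \<open>n\<close> indices are missing from \<open>U\<close>; and each column has at most \<open>s + 1\<close> nonzero entries, which
  bounds the cost of the updates.\<close>

section \<open>Column selection and transposed inverses\<close>

text \<open>\<open>submatrix\<close> finds its columns through \<open>pick\<close>; on an initial
  segment this is the identity, so \<open>row_submatrix\<close> leaves the columns in place.\<close>

lemma pick_atLeast0LessThan: "j < n \<Longrightarrow> pick {0..<n} j = j"
proof (induction j)
  case 0
  then show ?case by simp
next
  case (Suc j)
  have "(LEAST a. a \<in> {0..<n} \<and> j < a) = Suc j"
    using Suc.prems by (intro Least_equality) auto
  with Suc show ?case by simp
qed

text \<open>Transposing a left inverse gives a right inverse of the transpose; applied to a unit
  vector it yields a rooting vector.\<close>

lemma mult_transpose_left_inverse_unit:
  fixes A B :: "'a :: comm_semiring_1 mat"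
  assumes "A \<in> carrier_mat n n" "B \<in> carrier_mat n n" "B * A = 1\<^sub>m n"
  shows "transpose_mat A *\<^sub>v (transpose_mat B *\<^sub>v unit_vec n i) = unit_vec n i"
proof -
  have "transpose_mat A *\<^sub>v (transpose_mat B *\<^sub>v unit_vec n i)
      = (transpose_mat A * transpose_mat B) *\<^sub>v unit_vec n i"
    using assms(1,2) by (intro assoc_mult_mat_vec[symmetric]) auto
  also have "transpose_mat A * transpose_mat B = 1\<^sub>m n"
    using assms transpose_mult[OF assms(2,1)] by (metis transpose_one)
  finally show ?thesis by simp
qed

section \<open>One received set and its linear relations\<close>

locale hybrid_decoding =
  fixes n s r t :: nat and M A :: "real mat" and x :: "real vec" and U :: "nat set"
  assumes n_pos: "n \<ge> 1" and s_pos: "s \<ge> 1" and n_dvd_r: "n dvd r"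
    and A: "A \<in> carrier_mat r t" and x: "x \<in> carrier_vec t"
    and code: "s_diagonal_code n s M"
    and band_nonzero: "\<And>i j. i < n + s \<Longrightarrow> j < n \<Longrightarrow> in_band s i j \<Longrightarrow> M $$ (i, j) \<noteq> 0"
    and inv_U: "invertible_mat (row_submatrix n M U)"
    and U: "U \<subseteq> {0..<n + s}" and card_U: "card U = n"
begin

definition "q = r div n"
definition "R = {0..<n} - (U \<inter> {0..<n})"
definition "y l = row_block n A l *\<^sub>v x"

abbreviation "step \<equiv> decode_step n q M U R"

lemma finite_U: "finite U"
  using U finite_subset by blast

lemma M_carrier: "M \<in> carrier_mat (n + s) n"
  using code by (simp add: s_diagonal_code_def)

lemma M_off_band: "i < n + s \<Longrightarrow> j < n \<Longrightarrow> \<not> in_band s i j \<Longrightarrow> M $$ (i, j) = 0"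
  using code by (simp add: s_diagonal_code_def)

lemma dim_y [simp]: "dim_vec (y l) = q"
  using A by (simp add: y_def row_block_def q_def Let_def)

lemma dim_row_coded_block [simp]: "dim_row (coded_block n M A j) = q"
  using A by (simp add: coded_block_def q_def)

text \<open>Linearity of the code, by exchanging the sums over blocks and columns. The left side is
  what an entry of \<open>coded_block n M A j *\<^sub>v x\<close> simplifies to.\<close>

lemma coded_result_index:
  assumes "a < q"
  shows "row (coded_block n M A j) a \<bullet> x = (\<Sum>l<n. M $$ (j, l) * y l $ a)"
proof -
  have "row (coded_block n M A j) a \<bullet> x
      = (\<Sum>b = 0..<t. (\<Sum>l<n. M $$ (j, l) * row_block n A l $$ (a, b)) * x $ b)"
    using assms A x by (simp add: coded_block_def q_def scalar_prod_def)
  also have "\<dots> = (\<Sum>l<n. M $$ (j, l) * (\<Sum>b = 0..<t. row_block n A l $$ (a, b) * x $ b))"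
    by (simp add: sum_distrib_left sum_distrib_right sum.swap[of _ "{..<n}"] mult.assoc)
  also have "\<dots> = (\<Sum>l<n. M $$ (j, l) * y l $ a)"
    using assms A x by (simp add: y_def row_block_def q_def scalar_prod_def Let_def)
  finally show ?thesis .
qed

lemma workers_in_U: "{i. i < dim_row M \<and> i \<in> U} = U"
  using U M_carrier by auto

lemma row_submatrix_carrier: "row_submatrix n M U \<in> carrier_mat n n"
proof -
  have "{j. j < dim_col M \<and> j \<in> {0..<n}} = {0..<n}"
    using M_carrier by auto
  then show ?thesis
    by (intro carrier_matI)
      (simp_all only: row_submatrix_def dim_submatrix workers_in_U card_U card_atLeastLessThan diff_zero)
qed

lemma row_submatrix_index:
  assumes "l < n" "j < n"
  shows "row_submatrix n M U $$ (l, j) = M $$ (pick U l, j)"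
proof -
  have "{j. j < dim_col M \<and> j \<in> {0..<n}} = {0..<n}"
    using M_carrier by auto
  then have "row_submatrix n M U $$ (l, j) = M $$ (pick U l, pick {0..<n} j)"
    unfolding row_submatrix_def using assms
    by (intro submatrix_index) (simp_all only: workers_in_U card_U card_atLeastLessThan diff_zero)
  then show ?thesis
    using assms by (simp add: pick_atLeast0LessThan)
qed

text \<open>Ensures that a rooting step for an unrecovered block of \<open>R\<close> is never
  blocked.\<close>

lemma rooting_vector_exists:
  "\<exists>u \<in> carrier_vec n. transpose_mat (row_submatrix n M U) *\<^sub>v u = unit_vec n i"
proof -
  let ?S = "row_submatrix n M U"
  from inv_U obtain B where "inverts_mat ?S B" and BS: "inverts_mat B ?S"
    unfolding invertible_mat_def by blast
  then have SB: "?S * B = 1\<^sub>m n" and BS: "B * ?S = 1\<^sub>m (dim_row B)"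
    using row_submatrix_carrier by (auto simp: inverts_mat_def)
  \<comment> \<open>\<open>invertible_mat\<close> does not state the shape of \<open>B\<close>; it
    is read off the column counts of the two products.\<close>
  have "dim_row B = n" "dim_col B = n"
    using arg_cong[OF SB, of dim_col] arg_cong[OF BS, of dim_col] row_submatrix_carrier by auto
  then have "B \<in> carrier_mat n n" "B * ?S = 1\<^sub>m n"
    using BS by auto
  then show ?thesis
    using mult_transpose_left_inverse_unit[OF row_submatrix_carrier, of B i]
    by (intro bexI[of _ "transpose_mat B *\<^sub>v unit_vec n i"]) auto
qed

text \<open>Entrywise reading of the rooting equation: the weights \<open>u\<close> cancel every
  block but \<open>i\<close>.\<close>

lemma rooting_vector_sum:
  assumes "u \<in> carrier_vec n" "transpose_mat (row_submatrix n M U) *\<^sub>v u = unit_vec n i" "j < n" "i < n"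
  shows "(\<Sum>l<n. u $ l * M $$ (pick U l, j)) = (if j = i then 1 else 0)"
proof -
  have "(transpose_mat (row_submatrix n M U) *\<^sub>v u) $ j = (\<Sum>l<n. u $ l * M $$ (pick U l, j))"
    using assms(1,3) row_submatrix_carrier row_submatrix_index
    by (auto simp: scalar_prod_def lessThan_atLeast0 mult.commute intro!: sum.cong)
  then show ?thesis
    using assms by simp
qed

section \<open>Counting nonzero coefficients and missing blocks\<close>

text \<open>Column \<open>i\<close> of the band lies in rows \<open>i\<close> to
  \<open>i + s\<close>. This bounds the updates triggered by one recovery.\<close>

lemma column_support:
  assumes "i < n"
  shows "card {j \<in> U. M $$ (j, i) \<noteq> 0} \<le> s + 1"
proof -
  have "{j \<in> U. M $$ (j, i) \<noteq> 0} \<subseteq> {i..i + s}"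
    using U M_off_band[of _ i] assms by (force simp: in_band_def)
  from card_mono[OF _ this] show ?thesis by simp
qed

text \<open>As \<open>U\<close> has \<open>n\<close> elements, it misses as many indices below
  \<open>n\<close> as it contains from \<open>n\<close> on, and only \<open>s\<close> of the latter
  exist.\<close>

lemma card_R: "card R \<le> s"
proof -
  have "U - {0..<n} \<subseteq> {n..<n + s}"
    using U by auto
  then have "card (U - {0..<n}) \<le> s"
    using card_mono[of "{n..<n + s}"] by fastforce
  moreover have "card (U - {0..<n}) = n - card (U \<inter> {0..<n})"
    using finite_U card_U by (simp add: card_Diff_subset_Int)
  moreover have "card R = n - card (U \<inter> {0..<n})"
    unfolding R_def by (subst card_Diff_subset) auto
  ultimately show ?thesis by simp
qed

section \<open>The decoder invariant\<close>

text \<open>Updating and peeling for one block costs at most \<open>2 (s + 1) q + q \<le> 5 q s\<close>; a rooting combination costs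
  at most \<open>2 n q\<close> more.\<close>

definition decoder_inv :: "decoder \<Rightarrow> bool" where
  "decoder_inv \<sigma> \<longleftrightarrow>
     (\<forall>j\<in>U. \<forall>l<n. cur_coeff \<sigma> j l = (if recovered \<sigma> l = None then M $$ (j, l) else 0)) \<and>
     (\<forall>j\<in>U. dim_vec (cur_result \<sigma> j) = q \<and>
        (\<forall>a<q. cur_result \<sigma> j $ a = (\<Sum>l<n. cur_coeff \<sigma> j l * y l $ a))) \<and>
     (\<forall>l v. recovered \<sigma> l = Some v \<longrightarrow> l < n \<and> v = y l) \<and>
     rootings \<sigma> \<le> card (dom (recovered \<sigma>) \<inter> R) \<and>
     time \<sigma> \<le> 5 * (q * s) * card (dom (recovered \<sigma>)) + 2 * n * q * rootings \<sigma>"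

lemma decoder_invD:
  assumes "decoder_inv \<sigma>"
  shows "\<And>j l. j \<in> U \<Longrightarrow> l < n \<Longrightarrow> cur_coeff \<sigma> j l = (if recovered \<sigma> l = None then M $$ (j, l) else 0)"
    and "\<And>j. j \<in> U \<Longrightarrow> dim_vec (cur_result \<sigma> j) = q"
    and "\<And>j a. j \<in> U \<Longrightarrow> a < q \<Longrightarrow> cur_result \<sigma> j $ a = (\<Sum>l<n. cur_coeff \<sigma> j l * y l $ a)"
    and "\<And>l v. recovered \<sigma> l = Some v \<Longrightarrow> l < n \<and> v = y l"
    and "dom (recovered \<sigma>) \<subseteq> {0..<n}"
    and "rootings \<sigma> \<le> card (dom (recovered \<sigma>) \<inter> R)"
    and "time \<sigma> \<le> 5 * (q * s) * card (dom (recovered \<sigma>)) + 2 * n * q * rootings \<sigma>"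
  using assms unfolding decoder_inv_def by auto

lemma decoder_inv_init: "decoder_inv (init_decoder n M A x)"
  by (auto simp: decoder_inv_def init_decoder_def coded_result_index)

text \<open>Serves both kinds of step: \<open>k\<close> is the new number of rootings and
  \<open>c\<close> the cost beyond the updates. Peeling keeps \<open>k\<close> and has
  \<open>c = q\<close>; rooting raises \<open>k\<close> by one, which is allowed only for a block of
  \<open>R\<close>.\<close>

lemma decoder_inv_recover:
  assumes inv: "decoder_inv \<sigma>" and i: "i < n" "recovered \<sigma> i = None"
    and roots: "k \<le> rootings \<sigma> + (if i \<in> R then 1 else 0)"
    and cost: "c \<le> q + 2 * n * q * (k - rootings \<sigma>)" "rootings \<sigma> \<le> k"
  shows "decoder_inv (recover_block q U i (y i) \<sigma>
           \<lparr>rootings := k, time := time (recover_block q U i (y i) \<sigma>) + c\<rparr>)"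
proof -
  note invD = decoder_invD[OF inv]
  define J where "J = {j \<in> U. cur_coeff \<sigma> j i \<noteq> 0}"
  define \<tau> where "\<tau> = recover_block q U i (y i) \<sigma>"
  have \<tau>: "cur_coeff \<tau> = (\<lambda>j l. if j \<in> J \<and> l = i then 0 else cur_coeff \<sigma> j l)"
    "cur_result \<tau> = (\<lambda>j. if j \<in> J then cur_result \<sigma> j - cur_coeff \<sigma> j i \<cdot>\<^sub>v y i else cur_result \<sigma> j)"
    "recovered \<tau> = (recovered \<sigma>)(i \<mapsto> y i)" "time \<tau> = time \<sigma> + card J * (2 * q)"
    by (simp_all add: \<tau>_def recover_block_def J_def Let_def)
  have fin: "finite (dom (recovered \<sigma>))"
    using invD(5) finite_subset by blast
  have dom: "dom (recovered \<tau>) = insert i (dom (recovered \<sigma>))" "i \<notin> dom (recovered \<sigma>)"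
    using i by (auto simp: \<tau>)
  \<comment> \<open>Block \<open>i\<close> is unrecovered, so its current column is still the
    original one.\<close>
  have "card J \<le> s + 1"
    using column_support[OF i(1)] invD(1)[OF _ i(1)] i(2) by (simp add: J_def cong: conj_cong)
  then have "card J * (2 * q) \<le> (s + 1) * (2 * q)"
    by (rule mult_right_mono) simp
  moreover have "(s + 1) * (2 * q) = 2 * (q * s) + 2 * q"
    by (simp add: algebra_simps)
  \<comment> \<open>With \<open>s \<ge> 1\<close> the total \<open>2 * (q * s) + 3 * q\<close> is
    absorbed into \<open>5 * (q * s)\<close>.\<close>
  moreover have "q \<le> q * s"
    using s_pos by simp
  ultimately have "card J * (2 * q) + q \<le> 5 * (q * s)"
    by linarith
  moreover have "2 * n * q * rootings \<sigma> + 2 * n * q * (k - rootings \<sigma>) = 2 * n * q * k"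
    using cost(2) by (simp add: distrib_left[symmetric] mult.assoc)
  moreover have "card (dom (recovered \<tau>)) = Suc (card (dom (recovered \<sigma>)))"
    using fin dom(2) unfolding dom(1) by simp
  ultimately have "time \<tau> + c \<le> 5 * (q * s) * card (dom (recovered \<tau>)) + 2 * n * q * k"
    using invD(7) cost(1) unfolding \<tau>(4) by simp
  moreover have "k \<le> card (dom (recovered \<tau>) \<inter> R)"
    using roots invD(6) fin dom(2) unfolding dom(1) by (simp split: if_splits)
  moreover have "cur_coeff \<tau> j l = (if recovered \<tau> l = None then M $$ (j, l) else 0)"
    if "j \<in> U" "l < n" for j l
    using invD(1)[OF that] that by (auto simp: \<tau> J_def)
  moreover have "dim_vec (cur_result \<tau> j) = q" if "j \<in> U" for j
    using invD(2)[OF that] by (simp add: \<tau>)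
  moreover have "cur_result \<tau> j $ a = (\<Sum>l<n. cur_coeff \<tau> j l * y l $ a)"
    if "j \<in> U" "a < q" for j a
  proof -
    \<comment> \<open>Outside \<open>J\<close> the coefficient of block \<open>i\<close> is 0, so
      the subtraction formula covers both cases.\<close>
    have "cur_result \<tau> j $ a = (\<Sum>l<n. cur_coeff \<sigma> j l * y l $ a) - cur_coeff \<sigma> j i * y i $ a"
      using that invD(3)[OF that] invD(2)[OF that(1)] by (auto simp: \<tau> J_def)
    also have "\<dots> = (\<Sum>l\<in>{..<n} - {i}. cur_coeff \<sigma> j l * y l $ a)"
      using i(1) by (simp add: sum_diff1)
    also have "\<dots> = (\<Sum>l<n. cur_coeff \<tau> j l * y l $ a)"
      using that by (intro sum.mono_neutral_cong_left) (auto simp: \<tau> J_def)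
    finally show ?thesis .
  qed
  moreover have "l < n \<and> v = y l" if "recovered \<tau> l = Some v" for l v
    using that i(1) invD(4) by (auto simp: \<tau> split: if_splits)
  ultimately show ?thesis
    by (simp add: decoder_inv_def \<tau>_def[symmetric])
qed

section \<open>Correctness of the recovered values\<close>

text \<open>By the invariant, the result of a ripple row is the single term
  \<open>cur_coeff \<sigma> i' i\<close> times block \<open>i\<close>.\<close>

lemma peel_value:
  assumes "decoder_inv \<sigma>" "i' \<in> U" "{l \<in> {0..<n}. cur_coeff \<sigma> i' l \<noteq> 0} = {i}"
  shows "(1 / cur_coeff \<sigma> i' i) \<cdot>\<^sub>v cur_result \<sigma> i' = y i"
proof (rule eq_vecI)
  note invD = decoder_invD[OF assms(1)]
  fix a assume "a < dim_vec (y i)"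
  then have a: "a < q" by simp
  have "(\<Sum>l<n. cur_coeff \<sigma> i' l * y l $ a) = (\<Sum>l\<in>{i}. cur_coeff \<sigma> i' l * y l $ a)"
    using assms(3) by (intro sum.mono_neutral_right) auto
  moreover have "cur_coeff \<sigma> i' i \<noteq> 0"
    using assms(3) by auto
  ultimately show "((1 / cur_coeff \<sigma> i' i) \<cdot>\<^sub>v cur_result \<sigma> i') $ a = y i $ a"
    using invD(2,3)[OF assms(2)] a by simp
qed (use decoder_invD(2)[OF assms(1,2)] in simp)

text \<open>Subtracting recovered blocks does not spoil the rooting combination: it deletes only terms with
  coefficient \<open>(e\<^sub>i)\<^sub>j = 0\<close>, as block \<open>i\<close> itself is still unrecovered.\<close>

lemma root_value:
  assumes inv: "decoder_inv \<sigma>" and i: "i < n" "recovered \<sigma> i = None"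
    and u: "u \<in> carrier_vec n" "transpose_mat (row_submatrix n M U) *\<^sub>v u = unit_vec n i"
  shows "vec q (\<lambda>a. \<Sum>l<n. u $ l * cur_result \<sigma> (pick U l) $ a) = y i"
proof (rule eq_vecI)
  note invD = decoder_invD[OF inv]
  have pick: "pick U l \<in> U" if "l < n" for l
    using that card_U by (simp add: pick_in_set_le)
  fix a assume "a < dim_vec (y i)"
  then have a: "a < q" by simp
  have "(\<Sum>l<n. u $ l * cur_result \<sigma> (pick U l) $ a)
      = (\<Sum>l<n. \<Sum>j<n. u $ l * (cur_coeff \<sigma> (pick U l) j * y j $ a))"
    using a pick by (simp add: invD(3) sum_distrib_left)
  \<comment> \<open>Grouping by block \<open>j\<close> exposes the \<open>j\<close>-th entry of the
    rooting equation as its total weight.\<close>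
  also have "\<dots> = (\<Sum>j<n. \<Sum>l<n. u $ l * (cur_coeff \<sigma> (pick U l) j * y j $ a))"
    by (rule sum.swap)
  also have "\<dots> = (\<Sum>j<n. if j = i then y i $ a else 0)"
  proof (rule sum.cong[OF refl])
    fix j assume "j \<in> {..<n}"
    then have j: "j < n" by simp
    have "(\<Sum>l<n. u $ l * (cur_coeff \<sigma> (pick U l) j * y j $ a))
        = (if recovered \<sigma> j = None then (\<Sum>l<n. u $ l * M $$ (pick U l, j)) * y j $ a else 0)"
      using pick j by (auto simp: invD(1) sum_distrib_right mult.assoc)
    then show "(\<Sum>l<n. u $ l * (cur_coeff \<sigma> (pick U l) j * y j $ a)) = (if j = i then y i $ a else 0)"
      using rooting_vector_sum[OF u j i(1)] i(2) by auto
  qed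
  also have "\<dots> = y i $ a"
    using i(1) by simp
  finally show "vec q (\<lambda>a. \<Sum>l<n. u $ l * cur_result \<sigma> (pick U l) $ a) $ a = y i $ a"
    using a by simp
qed simp

section \<open>Effect of a step and absence of deadlock\<close>

lemma step_preserves:
  assumes inv: "decoder_inv \<sigma>" and "step \<sigma> \<sigma>'"
  shows "decoder_inv \<sigma>' \<and> card (dom (recovered \<sigma>')) = Suc (card (dom (recovered \<sigma>)))"
proof -
  have card: "card (insert i (dom (recovered \<sigma>))) = Suc (card (dom (recovered \<sigma>)))"
    if "recovered \<sigma> i = None" for i
    using that decoder_invD(5)[OF inv] finite_subset[of _ "{0..<n}"]
    by (intro card_insert_disjoint) auto
  from assms(2) show ?thesis
  proof cases
    case (peel i' i \<tau>)
    have "i \<in> {l \<in> {0..<n}. cur_coeff \<sigma> i' l \<noteq> 0}"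
      unfolding peel(3) by simp
    \<comment> \<open>Coefficients of recovered blocks are 0, so the column of a ripple belongs to
      an unrecovered block.\<close>
    then have i: "i < n" "recovered \<sigma> i = None"
      using decoder_invD(1)[OF inv peel(2), of i] by (auto split: if_splits)
    have \<tau>: "\<tau> = recover_block q U i (y i) \<sigma>"
      using peel(5) unfolding peel_value[OF inv peel(2,3)] .
    have "decoder_inv (\<tau>\<lparr>rootings := rootings \<sigma>, time := time \<tau> + q\<rparr>)"
      unfolding \<tau> by (rule decoder_inv_recover[OF inv i]) simp_all
    \<comment> \<open>Writing back the unchanged rooting count gives the state the shape used by
      \<open>decoder_inv_recover\<close>.\<close>
    moreover have "\<sigma>' = \<tau>\<lparr>rootings := rootings \<sigma>, time := time \<tau> + q\<rparr>"
      unfolding peel(1) by (simp add: \<tau> recover_block_def Let_def)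
    moreover have "dom (recovered \<sigma>') = insert i (dom (recovered \<sigma>))"
      unfolding peel(1) \<tau> by (simp add: recover_block_def Let_def)
    ultimately show ?thesis
      using card[OF i(2)] by simp
  next
    case (root i u \<tau>)
    have i: "i < n" "recovered \<sigma> i = None"
      using root(2,3) by (auto simp: R_def)
    have \<tau>: "\<tau> = recover_block q U i (y i) \<sigma>"
      using root(6) unfolding root_value[OF inv i root(4,5)] .
    have rootings: "rootings \<tau> = rootings \<sigma>"
      by (simp add: \<tau> recover_block_def Let_def)
    have "(n + (n - 1)) * q \<le> (2 * n) * q"
      by (rule mult_right_mono) simp_all
    then have cost: "(n + (n - 1)) * q \<le> q + 2 * n * q * (rootings \<sigma> + 1 - rootings \<sigma>)"
      unfolding add_diff_cancel_left' mult_1_right by (rule trans_le_add2)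
    have "decoder_inv (\<tau>\<lparr>rootings := rootings \<sigma> + 1, time := time \<tau> + (n + (n - 1)) * q\<rparr>)"
      unfolding \<tau> using root(2) by (intro decoder_inv_recover[OF inv i _ cost]) simp_all
    moreover have "dom (recovered \<sigma>') = insert i (dom (recovered \<sigma>))"
      unfolding root(1) \<tau> by (simp add: recover_block_def Let_def)
    ultimately show ?thesis
      using card[OF i(2)] rootings unfolding root(1) by simp
  qed
qed

text \<open>In a stuck state, the least unrecovered block would admit a rooting step if it is in
  \<open>R\<close> and a peeling step from its own row otherwise. Hence any interleaving of the two
  kinds succeeds.\<close>

lemma progress:
  assumes inv: "decoder_inv \<sigma>" and final: "\<nexists>\<sigma>'. step \<sigma> \<sigma>'" and "i < n"
  shows "recovered \<sigma> i \<noteq> None"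
  using \<open>i < n\<close>
proof (induction i rule: less_induct)
  case (less i)
  show ?case
  proof
    assume None: "recovered \<sigma> i = None"
    show False
    proof (cases "i \<in> R")
      case True
      then show False
        using rooting_vector_exists[of i] None final decode_step.root by blast
    next
      case False
      then have i: "i \<in> U"
        using less.prems by (auto simp: R_def)
      have "cur_coeff \<sigma> i l \<noteq> 0 \<longleftrightarrow> l = i" if "l < n" for l
      proof -
        \<comment> \<open>Left of the diagonal the blocks are already eliminated, by induction; on
          it the band entry is nonzero; right of it the code vanishes.\<close>
        consider "l < i" | "l = i" | "i < l" by linarith
        then show ?thesis
        proof cases
          case 1
          then show ?thesis
            using less.IH[OF 1 that] decoder_invD(1)[OF inv i that] by auto
        next
          case 2
          then show ?thesis
            using None decoder_invD(1)[OF inv i that] band_nonzero[of i i] that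
            by (simp add: in_band_def)
        next
          case 3
          then show ?thesis
            using decoder_invD(1)[OF inv i that] M_off_band[of i l] that less.prems
            by (simp add: in_band_def)
        qed
      qed
      then have "{l \<in> {0..<n}. cur_coeff \<sigma> i l \<noteq> 0} = {i}"
        using less.prems by auto
      from decode_step.peel[OF i this False refl] final show False
        by blast
    qed
  qed
qed

lemma decoder_inv_steps:
  assumes "step\<^sup>*\<^sup>* (init_decoder n M A x) \<sigma>"
  shows "decoder_inv \<sigma>"
  using assms by induction (use decoder_inv_init step_preserves in blast)+

section \<open>Termination, completeness and total cost\<close>

text \<open>Each step recovers a new block and there are only \<open>n\<close>, so a run cannot
  reach state \<open>Suc n\<close>.\<close>

theorem terminates: "\<nexists>\<sigma>. \<sigma> 0 = init_decoder n M A x \<and> (\<forall>k::nat. step (\<sigma> k) (\<sigma> (Suc k)))"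
proof
  assume "\<exists>\<sigma>. \<sigma> 0 = init_decoder n M A x \<and> (\<forall>k::nat. step (\<sigma> k) (\<sigma> (Suc k)))"
  then obtain \<sigma> where \<sigma>: "\<sigma> 0 = init_decoder n M A x" "\<And>k::nat. step (\<sigma> k) (\<sigma> (Suc k))"
    by blast
  have k: "decoder_inv (\<sigma> k) \<and> k \<le> card (dom (recovered (\<sigma> k)))" for k
  proof (induction k)
    case 0
    then show ?case by (simp add: \<sigma>(1) decoder_inv_init)
  next
    case (Suc k)
    then show ?case using step_preserves[OF _ \<sigma>(2)[of k]] by auto
  qed
  have "card (dom (recovered (\<sigma> (Suc n)))) \<le> n"
    using card_mono[OF _ decoder_invD(5)] k[of "Suc n"] by simp
  with k[of "Suc n"] show False by simp
qed

theorem final_state: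
  assumes "step\<^sup>*\<^sup>* (init_decoder n M A x) \<sigma>" and "\<nexists>\<sigma>'. step \<sigma> \<sigma>'"
  shows "\<forall>i<n. recovered \<sigma> i = Some (y i)" and "rootings \<sigma> \<le> s" and "time \<sigma> \<le> 7 * r * s"
proof -
  have inv: "decoder_inv \<sigma>"
    using assms(1) by (rule decoder_inv_steps)
  note invD = decoder_invD[OF inv]
  show "\<forall>i<n. recovered \<sigma> i = Some (y i)"
    using progress[OF inv assms(2)] invD(4) by blast
  have "card (dom (recovered \<sigma>) \<inter> R) \<le> card R"
    by (intro card_mono) (auto simp: R_def)
  then show roots: "rootings \<sigma> \<le> s"
    using invD(6) card_R by linarith
  have "card (dom (recovered \<sigma>)) \<le> n"
    using card_mono[OF _ invD(5)] by simp
  \<comment> \<open>At most \<open>n\<close> recoveries and at most \<open>s\<close> rootings;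
    \<open>n * q = r\<close> then gives 5 + 2 = 7 as the constant.\<close>
  then have "5 * (q * s) * card (dom (recovered \<sigma>)) + 2 * n * q * rootings \<sigma>
      \<le> 5 * (q * s) * n + 2 * n * q * s"
    using roots by (intro add_mono mult_left_mono) simp_all
  also have "\<dots> = 7 * (n * q) * s"
    by (simp add: algebra_simps)
  also have "n * q = r"
    using n_dvd_r by (simp add: q_def)
  finally show "time \<sigma> \<le> 7 * r * s"
    using invD(7) by linarith
qed

end

text \<open>Since the order of steps is left open, success is expressed for all runs: none is
  infinite, and every reachable state without a successor is complete and within the bounds.\<close>

theorem theorem6:
  shows "\<exists>C::real. C > 0 \<and>
    (\<forall>(n::nat) (s::nat) (r::nat) (t::nat) (M::real mat) (U::nat set) (A::real mat) (x::real vec).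
      n \<ge> 1 \<longrightarrow> s \<ge> 1 \<longrightarrow> n dvd r \<longrightarrow>
      A \<in> carrier_mat r t \<longrightarrow> x \<in> carrier_vec t \<longrightarrow>
      s_diagonal_code n s M \<longrightarrow>
      (\<forall>i<n + s. \<forall>j<n. in_band s i j \<longrightarrow> M $$ (i, j) \<noteq> 0) \<longrightarrow>
      (\<forall>W. W \<subseteq> {0..<n + s} \<and> card W = n \<longrightarrow> invertible_mat (row_submatrix n M W)) \<longrightarrow>
      U \<subseteq> {0..<n + s} \<longrightarrow> card U = n \<longrightarrow>
      (let step = decode_step n (r div n) M U ({0..<n} - (U \<inter> {0..<n}));
           init = init_decoder n M A x
       in (\<nexists>\<sigma>. \<sigma> 0 = init \<and> (\<forall>k::nat. step (\<sigma> k) (\<sigma> (Suc k)))) \<and>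
          (\<forall>\<sigma>. step\<^sup>*\<^sup>* init \<sigma> \<and> (\<nexists>\<sigma>'. step \<sigma> \<sigma>') \<longrightarrow>
             (\<forall>i<n. recovered \<sigma> i = Some (row_block n A i *\<^sub>v x)) \<and>
             rootings \<sigma> \<le> s \<and>
             real (time \<sigma>) \<le> C * real r * real s)))"
proof (intro exI[of _ 7] conjI allI impI, goal_cases)
  case 1
  then show ?case by simp
next
  case (2 n s r t M U A x)
  interpret hybrid_decoding n s r t M A x U
    using 2 by unfold_locales auto
  have "real (time \<sigma>) \<le> 7 * real r * real s" if "time \<sigma> \<le> 7 * r * s" for \<sigma> :: decoder
    using of_nat_mono[OF that, where 'a = real] by simp
  then show ?case
    using terminates final_state unfolding Let_def q_def R_def y_def by blast
qed

end
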